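(* Let $(\mathfrak{g}_T,[\,,\,]_{\mathfrak{g}})$ be a Rota-Baxter Leibniz algebra and $(V,l_V,r_V,T_V)$ a representation of it. Then the maps $d^n:C^n_{RBLA}(\mathfrak{g},V)\to C^{n+1}_{RBLA}(\mathfrak{g},V)$ satisfy $d^{n+1}\circ d^n=0$ for all $n\ge 0$.
   Context: All vector spaces are over a fixed field $\mathbb{K}$. A (left) Leibniz algebra is a vector space $\mathfrak{g}$ with a bilinear bracket satisfying $[x,[y,z]_{\mathfrak{g}}]_{\mathfrak{g}}=[[x,y]_{\mathfrak{g}},z]_{\mathfrak{g}}+[y,[x,z]_{\mathfrak{g}}]_{\mathfrak{g}}$. A Rota-Baxter operator is a linear map $T:\mathfrak{g}\to\mathfrak{g}$ with $[T(x),T(y)]_{\mathfrak{g}}=T([T(x),y]_{\mathfrak{g}}+[x,T(y)]_{\mathfrak{g}})$. A Rota-Baxter Leibniz algebra $(\mathfrak{g}_T,[\,,\,]_{\mathfrak{g}})$ is a Leibniz algebra together with a Rota-Baxter operator $T$. A representation of a Leibniz algebra $\mathfrak{g}$ is $(V,l_V,r_V)$ with bilinear $l_V:\mathfrak{g}\otimes V\to V$, $r_V:V\otimes\mathfrak{g}\to V$ such that $l_V(x,l_V(y,u))=l_V([x,y]_{\mathfrak{g}},u)+l_V(y,l_V(x,u))$, $l_V(x,r_V(u,y))=r_V(l_V(x,u),y)+r_V(u,[x,y]_{\mathfrak{g}})$, $r_V(u,[x,y]_{\mathfrak{g}})=r_V(r_V(u,x),y)+l_V(x,r_V(u,y))$.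 A representation of $(\mathfrak{g}_T,[\,,\,]_{\mathfrak{g}})$ is $(V,l_V,r_V,T_V)$ where in addition $T_V:V\to V$ is linear with $l_V(T(x),T_V(u))=T_V(l_V(T(x),u)+l_V(x,T_V(u)))$ and $r_V(T_V(u),T(x))=T_V(r_V(T_V(u),x)+r_V(u,T(x)))$. Put $C^n_{LA}(\mathfrak{g},V)=C^n_{RBO}(\mathfrak{g},V)=\mathrm{Hom}(\mathfrak{g}^{\otimes n},V)$ for $n\ge 0$ (so both equal $V$ for $n=0$). The map $\delta^n:C^n_{LA}(\mathfrak{g},V)\to C^{n+1}_{LA}(\mathfrak{g},V)$ is $$\begin{aligned}(\delta^n f)(x_1,\dots,x_{n+1})=&\sum_{i=1}^{n}(-1)^{i+1}l_V(x_i,f(x_1,\dots,\widehat{x_i},\dots,x_{n+1}))+(-1)^{n+1}r_V(f(x_1,\dots,x_n),x_{n+1})\\&+\sum_{1\le i<j\le n+1}(-1)^i f(x_1,\dots,\widehat{x_i},\dots,x_{j-1},[x_i,x_j]_{\mathfrak{g}},x_{j+1},\dots,x_{n+1}).\end{aligned}$$ Put $[x,y]_*=[x,T(y)]_{\mathfrak{g}}+[T(x),y]_{\mathfrak{g}}$, $l'_V(x,u)=l_V(T(x),u)-T_V(l_V(x,u))$, $r'_V(u,x)=r_V(u,T(x))-T_V(r_V(u,x))$. The map $\partial^n:C^n_{RBO}(\mathfrak{g},V)\to C^{n+1}_{RBO}(\mathfrak{g},V)$ is given by the same formula as $\delta^n$ with $l_V,r_V,[\,,\,]_{\mathfrak{g}}$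 replaced by $l'_V,r'_V,[\,,\,]_*$. The map $\phi^n:C^n_{LA}(\mathfrak{g},V)\to C^n_{RBO}(\mathfrak{g},V)$ is $$\phi^n(f)(x_1,\dots,x_n)=f(Tx_1,\dots,Tx_n)-\sum_{i=1}^n T_V\big(f(Tx_1,\dots,Tx_{i-1},x_i,Tx_{i+1},\dots,Tx_n)\big)$$ (so $\phi^0=\mathrm{id}_V$). Define $C^0_{RBLA}(\mathfrak{g},V)=C^0_{LA}(\mathfrak{g},V)$ and $C^n_{RBLA}(\mathfrak{g},V)=C^n_{LA}(\mathfrak{g},V)\oplus C^{n-1}_{RBO}(\mathfrak{g},V)$ for $n\ge 1$. For $n\geq 1$, $d^n(\alpha,\beta)=(\delta^n(\alpha),-\partial^{n-1}(\beta)-\phi^n(\alpha))$; for $n=0$, $d^0(\alpha)=(\delta^0(\alpha),-\phi^0(\alpha))$. *)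

theory Defs
  imports Complex_Main "HOL-Library.Function_Algebras" "HOL-Library.Product_Plus"
begin

definition bilinear_map ::
  "('k::field \<Rightarrow> 'a::ab_group_add \<Rightarrow> 'a) \<Rightarrow> ('k \<Rightarrow> 'b::ab_group_add \<Rightarrow> 'b) \<Rightarrow>
   ('k \<Rightarrow> 'c::ab_group_add \<Rightarrow> 'c) \<Rightarrow> ('a \<Rightarrow> 'b \<Rightarrow> 'c) \<Rightarrow> bool" where
  "bilinear_map s1 s2 s3 b \<longleftrightarrow>
     (\<forall>x. Vector_Spaces.linear s2 s3 (\<lambda>y. b x y)) \<and>
     (\<forall>y. Vector_Spaces.linear s1 s3 (\<lambda>x. b x y))"

locale leibniz_algebra = vector_space scale
  for scale :: "'k::field \<Rightarrow> 'g::ab_group_add \<Rightarrow> 'g" +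
  fixes br :: "'g \<Rightarrow> 'g \<Rightarrow> 'g"
  assumes bilinear_br: "bilinear_map scale scale scale br"
    and leibniz: "br x (br y z) = br (br x y) z + br y (br x z)"

locale rota_baxter_leibniz_algebra = leibniz_algebra scale br
  for scale :: "'k::field \<Rightarrow> 'g::ab_group_add \<Rightarrow> 'g" and br +
  fixes T :: "'g \<Rightarrow> 'g"
  assumes linear_T: "Vector_Spaces.linear scale scale T"
    and rota_baxter: "br (T x) (T y) = T (br (T x) y + br x (T y))"

locale leibniz_representation = leibniz_algebra sG br + V: vector_space sV
  for sG :: "'k::field \<Rightarrow> 'g::ab_group_add \<Rightarrow> 'g" and br
    and sV :: "'k \<Rightarrow> 'v::ab_group_add \<Rightarrow> 'v" +
  fixes l :: "'g \<Rightarrow> 'v \<Rightarrow> 'v" and r :: "'v \<Rightarrow> 'g \<Rightarrow> 'v"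
  assumes bilinear_l: "bilinear_map sG sV sV l"
    and bilinear_r: "bilinear_map sV sG sV r"
    and rep_ll: "l x (l y u) = l (br x y) u + l y (l x u)"
    and rep_lr: "l x (r u y) = r (l x u) y + r u (br x y)"
    and rep_rr: "r u (br x y) = r (r u x) y + l x (r u y)"

locale rota_baxter_representation =
  rota_baxter_leibniz_algebra sG br T + leibniz_representation sG br sV l r
  for sG :: "'k::field \<Rightarrow> 'g::ab_group_add \<Rightarrow> 'g" and br T
    and sV :: "'k \<Rightarrow> 'v::ab_group_add \<Rightarrow> 'v" and l r +
  fixes TV :: "'v \<Rightarrow> 'v"
  assumes linear_TV: "Vector_Spaces.linear sV sV TV"
    and rep_l_T: "l (T x) (TV u) = TV (l (T x) u + l x (TV u))"
    and rep_r_T: "r (TV u) (T x) = TV (r (TV u) x + r u (T x))"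

text \<open>Elements of Hom(g^(tensor n), V) are the n-linear maps from g to V, taking their arguments
  as a list of length n. They are required to vanish on lists of any other length, so that equality
  of functions is equality of n-linear maps. For n = 0 the map f corresponds to the vector f [] in V.\<close>

definition cochains ::
  "('k::field \<Rightarrow> 'g::ab_group_add \<Rightarrow> 'g) \<Rightarrow> ('k \<Rightarrow> 'v::ab_group_add \<Rightarrow> 'v) \<Rightarrow> nat \<Rightarrow>
   ('g list \<Rightarrow> 'v) set" where
  "cochains sG sV n =
     {f. (\<forall>xs i. length xs = n \<longrightarrow> i < n \<longrightarrow> Vector_Spaces.linear sG sV (\<lambda>x. f (xs[i := x]))) \<and>
         (\<forall>xs. length xs \<noteq> n \<longrightarrow> f xs = 0)}"

definition omit :: "nat \<Rightarrow> 'a list \<Rightarrow> 'a list" where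
  "omit i xs = take i xs @ drop (Suc i) xs"

text \<open>List positions start at 0, so the argument x_i of the usual formula is xs ! (i - 1); the signs
  are shifted accordingly.\<close>

definition coboundary ::
  "('k::field \<Rightarrow> 'v::ab_group_add \<Rightarrow> 'v) \<Rightarrow> ('g \<Rightarrow> 'g \<Rightarrow> 'g) \<Rightarrow> ('g \<Rightarrow> 'v \<Rightarrow> 'v) \<Rightarrow> ('v \<Rightarrow> 'g \<Rightarrow> 'v) \<Rightarrow>
   nat \<Rightarrow> ('g list \<Rightarrow> 'v) \<Rightarrow> 'g list \<Rightarrow> 'v" where
  "coboundary sV br l r n f xs =
     (if length xs = n + 1 then
        (\<Sum>i<n. sV ((-1) ^ i) (l (xs ! i) (f (omit i xs))))
        + sV ((-1) ^ (n + 1)) (r (f (take n xs)) (xs ! n))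
        + (\<Sum>j<n + 1. \<Sum>i<j. sV ((-1) ^ (i + 1)) (f (omit i (xs[j := br (xs ! i) (xs ! j)]))))
      else 0)"

definition bracket_star :: "('g::ab_group_add \<Rightarrow> 'g \<Rightarrow> 'g) \<Rightarrow> ('g \<Rightarrow> 'g) \<Rightarrow> 'g \<Rightarrow> 'g \<Rightarrow> 'g" where
  "bracket_star br T x y = br x (T y) + br (T x) y"

definition left_prime ::
  "('g \<Rightarrow> 'g) \<Rightarrow> ('g \<Rightarrow> 'v \<Rightarrow> 'v) \<Rightarrow> ('v \<Rightarrow> 'v) \<Rightarrow> 'g \<Rightarrow> 'v::ab_group_add \<Rightarrow> 'v" where
  "left_prime T l TV x u = l (T x) u - TV (l x u)"

definition right_prime ::
  "('g \<Rightarrow> 'g) \<Rightarrow> ('v \<Rightarrow> 'g \<Rightarrow> 'v) \<Rightarrow> ('v \<Rightarrow> 'v) \<Rightarrow> 'v::ab_group_add \<Rightarrow> 'g \<Rightarrow> 'v" where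
  "right_prime T r TV u x = r u (T x) - TV (r u x)"

definition rbo_coboundary ::
  "('k::field \<Rightarrow> 'v::ab_group_add \<Rightarrow> 'v) \<Rightarrow> ('g::ab_group_add \<Rightarrow> 'g \<Rightarrow> 'g) \<Rightarrow> ('g \<Rightarrow> 'g) \<Rightarrow>
   ('g \<Rightarrow> 'v \<Rightarrow> 'v) \<Rightarrow> ('v \<Rightarrow> 'g \<Rightarrow> 'v) \<Rightarrow> ('v \<Rightarrow> 'v) \<Rightarrow>
   nat \<Rightarrow> ('g list \<Rightarrow> 'v) \<Rightarrow> 'g list \<Rightarrow> 'v" where
  "rbo_coboundary sV br T l r TV =
     coboundary sV (bracket_star br T) (left_prime T l TV) (right_prime T r TV)"

definition rb_phi ::
  "('g \<Rightarrow> 'g) \<Rightarrow> ('v \<Rightarrow> 'v) \<Rightarrow> nat \<Rightarrow> ('g list \<Rightarrow> 'v::ab_group_add) \<Rightarrow> 'g list \<Rightarrow> 'v" where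
  "rb_phi T TV n f xs =
     (if length xs = n then f (map T xs) - (\<Sum>i<n. TV (f ((map T xs)[i := xs ! i]))) else 0)"

text \<open>Degree 0 has only the first component, which is identified with its direct sum with the zero
  space so that all degrees live in one type.\<close>

definition rbla_cochains ::
  "('k::field \<Rightarrow> 'g::ab_group_add \<Rightarrow> 'g) \<Rightarrow> ('k \<Rightarrow> 'v::ab_group_add \<Rightarrow> 'v) \<Rightarrow> nat \<Rightarrow>
   (('g list \<Rightarrow> 'v) \<times> ('g list \<Rightarrow> 'v)) set" where
  "rbla_cochains sG sV n =
     (if n = 0 then cochains sG sV 0 \<times> {0} else cochains sG sV n \<times> cochains sG sV (n - 1))"

definition rbla_diff ::
  "('k::field \<Rightarrow> 'v::ab_group_add \<Rightarrow> 'v) \<Rightarrow> ('g::ab_group_add \<Rightarrow> 'g \<Rightarrow> 'g) \<Rightarrow> ('g \<Rightarrow> 'g) \<Rightarrow>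
   ('g \<Rightarrow> 'v \<Rightarrow> 'v) \<Rightarrow> ('v \<Rightarrow> 'g \<Rightarrow> 'v) \<Rightarrow> ('v \<Rightarrow> 'v) \<Rightarrow> nat \<Rightarrow>
   ('g list \<Rightarrow> 'v) \<times> ('g list \<Rightarrow> 'v) \<Rightarrow> ('g list \<Rightarrow> 'v) \<times> ('g list \<Rightarrow> 'v)" where
  "rbla_diff sV br T l r TV n = (\<lambda>(\<alpha>, \<beta>).
     if n = 0 then (coboundary sV br l r 0 \<alpha>, - rb_phi T TV 0 \<alpha>)
     else (coboundary sV br l r n \<alpha>,
           - rbo_coboundary sV br T l r TV (n - 1) \<beta> - rb_phi T TV n \<alpha>))"

end

theory Submission
  imports Defs
begin

text \<open>Write i_x f for f with first argument x inserted, and L_x for the action of x on cochains.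
  The coboundary satisfies Cartan's formula i_x \<delta> = L_x - \<delta> i_x in positive degree, and the
  identities [L_x, i_y] = i_[x,y] and [L_x, L_y] = L_[x,y] give L_x \<delta> = \<delta> L_x and then
  \<delta> \<delta> = 0, each by induction on the list of arguments. The primed operations form a
  representation of the Leibniz algebra with bracket [,]_*, so the same argument gives
  \<partial> \<partial> = 0. Since T and T_V intertwine the two representations, \<partial> \<phi> = \<phi> \<delta> follows
  from Cartan's formula and L'_x \<phi> f = \<phi> (L_(Tx) f) - T_V (L_x f) T.\<close>

section \<open>Recursive forms of the operators, and multilinearity without a degree\<close>

fun lie_act :: "('g \<Rightarrow> 'g \<Rightarrow> 'g) \<Rightarrow> ('g \<Rightarrow> 'v \<Rightarrow> 'v) \<Rightarrow> 'g \<Rightarrow> ('g list \<Rightarrow> 'v) \<Rightarrow> 'g list \<Rightarrow> 'v::ab_group_add"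
  where
    "lie_act br l x f [] = l x (f [])"
  | "lie_act br l x f (y # ys) = lie_act br l x (\<lambda>zs. f (y # zs)) ys - f (br x y # ys)"

text \<open>Cartan's formula serves as the recursion here, just as the commutator of action and
  insertion does for \<open>lie_act\<close>. Degree 0 is a separate equation because there the right
  action, not \<open>l\<close>, gives the value.\<close>

fun cartan_diff ::
  "('g \<Rightarrow> 'g \<Rightarrow> 'g) \<Rightarrow> ('g \<Rightarrow> 'v \<Rightarrow> 'v) \<Rightarrow> ('v \<Rightarrow> 'g \<Rightarrow> 'v) \<Rightarrow> ('g list \<Rightarrow> 'v) \<Rightarrow> 'g list \<Rightarrow> 'v::ab_group_add"
  where
    "cartan_diff br l r f [] = 0"
  | "cartan_diff br l r f [x] = - r (f []) x"
  | "cartan_diff br l r f (x # y # ys) =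
       lie_act br l x f (y # ys) - cartan_diff br l r (\<lambda>zs. f (x # zs)) (y # ys)"

fun rec_phi :: "('g \<Rightarrow> 'g) \<Rightarrow> ('v \<Rightarrow> 'v) \<Rightarrow> ('g list \<Rightarrow> 'v) \<Rightarrow> 'g list \<Rightarrow> 'v::ab_group_add" where
  "rec_phi T TV f [] = f []"
| "rec_phi T TV f (x # xs) = rec_phi T TV (\<lambda>zs. f (T x # zs)) xs - TV (f (x # map T xs))"

text \<open>No length is fixed, so the property survives inserting a first argument, which lowers
  the degree. Inductions over the argument list depend on this.\<close>

definition multilinear ::
  "('k::field \<Rightarrow> 'g::ab_group_add \<Rightarrow> 'g) \<Rightarrow> ('k \<Rightarrow> 'v::ab_group_add \<Rightarrow> 'v) \<Rightarrow> ('g list \<Rightarrow> 'v) \<Rightarrow> bool" where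
  "multilinear sG sV f \<longleftrightarrow> (\<forall>xs ys. Vector_Spaces.linear sG sV (\<lambda>x. f (xs @ x # ys)))"

lemma multilinear_hd: "multilinear sG sV f \<Longrightarrow> Vector_Spaces.linear sG sV (\<lambda>x. f (x # ys))"
  unfolding multilinear_def by (drule spec[of _ "[]"]) simp

lemma multilinear_Cons: "multilinear sG sV f \<Longrightarrow> multilinear sG sV (\<lambda>zs. f (x # zs))"
proof (unfold multilinear_def, intro allI)
  fix xs ys
  assume "\<forall>xs ys. Vector_Spaces.linear sG sV (\<lambda>x. f (xs @ x # ys))"
  from spec[OF this, of "x # xs"]
  show "Vector_Spaces.linear sG sV (\<lambda>z. f (x # xs @ z # ys))" by simp
qed

lemma multilinear_add:
  "multilinear sG sV f \<Longrightarrow> f ((x + y) # ys) = f (x # ys) + f (y # ys)"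
  using multilinear_hd[of sG sV f ys] by (simp add: Vector_Spaces.linear_iff)

context vector_space_pair
begin

text \<open>Slots in lists of length other than \<open>n\<close> impose nothing new:
  \<open>f\<close> vanishes there and the zero map is linear.\<close>

lemma cochains_iff:
  "f \<in> cochains s1 s2 n \<longleftrightarrow> multilinear s1 s2 f \<and> (\<forall>xs. length xs \<noteq> n \<longrightarrow> f xs = 0)"
proof
  assume f: "f \<in> cochains s1 s2 n"
  have "Vector_Spaces.linear s1 s2 (\<lambda>x. f (xs @ x # ys))" for xs ys
  proof (cases "Suc (length xs + length ys) = n")
    case True
    \<comment> \<open>The entry 0 is a placeholder; the update at position \<open>length xs\<close>
      overwrites it.\<close>
    moreover from True have "length xs < n" "length (xs @ 0 # ys) = n" by auto
    ultimately have "Vector_Spaces.linear s1 s2 (\<lambda>x. f ((xs @ 0 # ys)[length xs := x]))"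
      using f unfolding cochains_def by blast
    then show ?thesis by simp
  next
    case False
    then have "(\<lambda>x. f (xs @ x # ys)) = (\<lambda>x. 0)"
      using f unfolding cochains_def by auto
    then show ?thesis by (simp add: linear_zero)
  qed
  then show "multilinear s1 s2 f \<and> (\<forall>xs. length xs \<noteq> n \<longrightarrow> f xs = 0)"
    using f unfolding cochains_def multilinear_def by simp
next
  assume "multilinear s1 s2 f \<and> (\<forall>xs. length xs \<noteq> n \<longrightarrow> f xs = 0)"
  then show "f \<in> cochains s1 s2 n"
    unfolding cochains_def multilinear_def by (simp add: upd_conv_take_nth_drop)
qed

lemma cochains_uminus: "f \<in> cochains s1 s2 n \<Longrightarrow> - f \<in> cochains s1 s2 n"
  unfolding cochains_iff multilinear_def by (simp add: linear_compose_neg)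

lemma cochains_diff:
  "f \<in> cochains s1 s2 n \<Longrightarrow> g \<in> cochains s1 s2 n \<Longrightarrow> f - g \<in> cochains s1 s2 n"
  unfolding cochains_iff multilinear_def by (simp add: linear_compose_sub)

end

section \<open>Explicit sums versus recursions\<close>

lemma lie_act_eq_sum:
  "lie_act br l x f ys = l x (f ys) - (\<Sum>j<length ys. f (ys[j := br x (ys ! j)]))"
  by (induction br l x f ys rule: lie_act.induct) (simp_all add: sum.lessThan_Suc_shift del: sum.lessThan_Suc)

lemma omit_Cons [simp]: "omit 0 (x # xs) = xs" "omit (Suc i) (x # xs) = x # omit i xs"
  by (simp_all add: omit_def)

text \<open>The summands in which the first argument \<open>x\<close> acts or is bracketed into a
  later slot add up to \<open>lie_act br l x f\<close>. The others form the coboundary of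
  \<open>f\<close> with \<open>x\<close> inserted, with all signs reversed by the index
  shift.\<close>

lemma (in vector_space) coboundary_eq_cartan_diff:
  "length xs = Suc n \<Longrightarrow> coboundary scale br l r n f xs = cartan_diff br l r f xs"
proof (induction n arbitrary: xs f)
  case 0
  then obtain x where "xs = [x]" by (cases xs) auto
  then show ?case by (simp add: coboundary_def)
next
  case (Suc n)
  then obtain x y ys where xs: "xs = x # y # ys" and len: "length (y # ys) = Suc n"
    by (metis length_Suc_conv)
  let ?ys = "y # ys"
  let ?g = "\<lambda>zs. f (x # zs)"
  define A where "A = (\<Sum>i<n. scale ((-1) ^ i) (l (?ys ! i) (?g (omit i ?ys))))"
  define B where "B = scale ((-1) ^ Suc n) (r (?g (take n ?ys)) (?ys ! n))"
  define C where "C = (\<Sum>j<Suc n. \<Sum>i<j. scale ((-1) ^ Suc i) (?g (omit i (?ys[j := br (?ys ! i) (?ys ! j)]))))"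
  have g: "cartan_diff br l r ?g ?ys = A + B + C"
    using Suc.IH[OF len, of ?g] len unfolding coboundary_def A_def B_def C_def by simp
  have a: "(\<Sum>i<Suc n. scale ((-1) ^ i) (l (xs ! i) (f (omit i xs)))) = l x (f ?ys) - A"
    unfolding xs A_def sum.lessThan_Suc_shift by (simp add: sum_negf del: sum.lessThan_Suc)
  have b: "scale ((-1) ^ Suc (Suc n)) (r (f (take (Suc n) xs)) (xs ! Suc n)) = - B"
    unfolding xs B_def by simp
  \<comment> \<open>The index \<open>j = 0\<close> contributes an empty sum; for later
    \<open>j\<close> the term \<open>i = 0\<close> is the one that brackets \<open>x\<close> into a
    slot of \<open>?ys\<close>.\<close>
  have c: "(\<Sum>j<Suc (Suc n). \<Sum>i<j. scale ((-1) ^ Suc i) (f (omit i (xs[j := br (xs ! i) (xs ! j)]))))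
      = - (\<Sum>j<Suc n. f (?ys[j := br x (?ys ! j)])) - C"
    unfolding xs C_def sum.lessThan_Suc_shift[of _ "Suc n"]
    by (subst sum.lessThan_Suc_shift) (simp add: sum_negf sum_subtractf del: sum.lessThan_Suc)
  have "coboundary scale br l r (Suc n) f xs
      = (l x (f ?ys) - A) + - B + (- (\<Sum>j<Suc n. f (?ys[j := br x (?ys ! j)])) - C)"
    using Suc.prems a b c unfolding coboundary_def by (simp del: sum.lessThan_Suc power_Suc)
  also have "\<dots> = lie_act br l x f ?ys - cartan_diff br l r ?g ?ys"
    unfolding g lie_act_eq_sum len by simp
  finally show ?case unfolding xs by simp
qed

text \<open>The summand \<open>i = 0\<close> keeps \<open>x\<close> free of \<open>T\<close>; all
  other terms have \<open>T x\<close> in front and are handled by induction.\<close>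

lemma rb_phi_eq_rec_phi: "length xs = n \<Longrightarrow> rb_phi T TV n f xs = rec_phi T TV f xs"
proof (induction xs arbitrary: n f)
  case Nil
  then show ?case by (simp add: rb_phi_def)
next
  case (Cons x xs)
  then show ?case
    using Cons.IH[of "length xs" "\<lambda>zs. f (T x # zs)"]
    by (auto simp: rb_phi_def sum.lessThan_Suc_shift simp del: sum.lessThan_Suc)
qed

section \<open>Cartan calculus for a representation of a Leibniz algebra\<close>

context leibniz_representation
begin

sublocale GV: vector_space_pair sG sV ..

lemma linear_l: "Vector_Spaces.linear sV sV (l x)"
  and linear_l_left: "Vector_Spaces.linear sG sV (\<lambda>x. l x u)"
  using bilinear_l unfolding bilinear_map_def by auto

lemma linear_r: "Vector_Spaces.linear sG sV (r u)"
  and linear_r_left: "Vector_Spaces.linear sV sV (\<lambda>u. r u x)"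
  using bilinear_r unfolding bilinear_map_def by auto

lemma linear_br: "Vector_Spaces.linear sG sG (br x)"
  and linear_br_left: "Vector_Spaces.linear sG sG (\<lambda>x. br x y)"
  using bilinear_br unfolding bilinear_map_def by auto

lemmas linear_compose' = Vector_Spaces.linear_compose[unfolded o_def]

lemma additivity:
  "l x (u + v) = l x u + l x v" "l x (u - v) = l x u - l x v" "l x (- u) = - l x u" "l x 0 = 0"
  "r (u + v) x = r u x + r v x" "r (u - v) x = r u x - r v x" "r (- u) x = - r u x" "r 0 x = 0"
  "l (x + y) u = l x u + l y u" "r u (x + y) = r u x + r u y"
  "br x (y + z) = br x y + br x z" "br (x + y) z = br x z + br y z"
proof -
  interpret VV: vector_space_pair sV sV ..
  interpret GG: vector_space_pair sG sG ..
  show "l x (u + v) = l x u + l x v" "l x (u - v) = l x u - l x v" "l x (- u) = - l x u" "l x 0 = 0"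
    by (simp_all add: VV.linear_add[OF linear_l] VV.linear_diff[OF linear_l]
        VV.linear_neg[OF linear_l] VV.linear_0[OF linear_l])
  show "r (u + v) x = r u x + r v x" "r (u - v) x = r u x - r v x" "r (- u) x = - r u x" "r 0 x = 0"
    by (simp_all add: VV.linear_add[OF linear_r_left] VV.linear_diff[OF linear_r_left]
        VV.linear_neg[OF linear_r_left] VV.linear_0[OF linear_r_left])
  show "l (x + y) u = l x u + l y u" "r u (x + y) = r u x + r u y"
    by (simp_all add: GV.linear_add[OF linear_l_left] GV.linear_add[OF linear_r])
  show "br x (y + z) = br x y + br x z" "br (x + y) z = br x z + br y z"
    by (simp_all add: GG.linear_add[OF linear_br] GG.linear_add[OF linear_br_left])
qed

abbreviation "L \<equiv> lie_act br l"
abbreviation "D \<equiv> cartan_diff br l r"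

text \<open>The parameter enters through the cochain, as it does for
  \<open>F z = (\<lambda>zs. f (z # zs))\<close> once a first argument has been inserted.\<close>

lemma linear_lie_act_family:
  assumes "\<And>zs. Vector_Spaces.linear sG sV (\<lambda>z. F z zs)"
  shows "Vector_Spaces.linear sG sV (\<lambda>z. L x (F z) ys)"
  using assms
proof (induction ys arbitrary: F)
  case Nil
  show ?case unfolding lie_act.simps by (rule linear_compose'[OF Nil linear_l])
next
  case (Cons y ys)
  show ?case unfolding lie_act.simps by (rule GV.linear_compose_sub Cons.IH Cons.prems)+
qed

lemma linear_cartan_diff_family:
  assumes "\<And>zs. Vector_Spaces.linear sG sV (\<lambda>z. F z zs)"
  shows "Vector_Spaces.linear sG sV (\<lambda>z. D (F z) ys)"
  using assms
proof (induction ys arbitrary: F rule: induct_list012)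
  case 1
  show ?case unfolding cartan_diff.simps by (rule GV.linear_zero)
next
  case (2 x)
  show ?case unfolding cartan_diff.simps
    by (rule GV.linear_compose_neg linear_compose'[OF _ linear_r_left] 2)+
next
  case (3 x y ys)
  show ?case unfolding cartan_diff.simps
    by (rule GV.linear_compose_sub linear_lie_act_family "3.IH"(2) "3.prems")+
qed

lemma linear_lie_act_left:
  "multilinear sG sV f \<Longrightarrow> Vector_Spaces.linear sG sV (\<lambda>x. L x f ys)"
proof (induction ys arbitrary: f)
  case Nil
  then show ?case by (simp add: linear_l_left)
next
  case (Cons y ys)
  show ?case unfolding lie_act.simps
    by (rule GV.linear_compose_sub Cons.IH multilinear_Cons[OF Cons.prems]
        linear_compose'[OF linear_br_left multilinear_hd[OF Cons.prems]])+
qed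

lemma multilinear_lie_act:
  assumes "multilinear sG sV f"
  shows "multilinear sG sV (L x f)"
proof -
  have "Vector_Spaces.linear sG sV (\<lambda>z. L x f (xs @ z # ys))" for xs ys
    using assms
  proof (induction xs arbitrary: f)
    case Nil
    show ?case unfolding append_Nil lie_act.simps
      by (rule GV.linear_compose_sub linear_lie_act_family multilinear_hd[OF Nil]
          linear_compose'[OF linear_br multilinear_hd[OF Nil]])+
  next
    case (Cons a xs)
    have "Vector_Spaces.linear sG sV (\<lambda>z. f ((br x a # xs) @ z # ys))"
      using Cons.prems unfolding multilinear_def by blast
    then show ?case unfolding append_Cons lie_act.simps
      by (rule GV.linear_compose_sub[OF Cons.IH[OF multilinear_Cons[OF Cons.prems]]])
  qed
  then show ?thesis unfolding multilinear_def by blast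
qed

lemma cartan_diff_Cons:
  "ys \<noteq> [] \<Longrightarrow> D f (x # ys) = L x f ys - D (\<lambda>zs. f (x # zs)) ys"
  by (cases ys) simp_all

text \<open>By Cartan's formula a slot at the head becomes the acting element and the inserted
  argument; any other slot lies in the tail, where induction applies.\<close>

lemma multilinear_cartan_diff:
  assumes "multilinear sG sV f"
  shows "multilinear sG sV (D f)"
proof -
  have "Vector_Spaces.linear sG sV (\<lambda>z. D f (xs @ z # ys))" for xs ys
    using assms
  proof (induction xs arbitrary: f)
    case Nil
    show ?case
    proof (cases "ys = []")
      case True
      show ?thesis unfolding True append_Nil cartan_diff.simps
        by (rule GV.linear_compose_neg linear_r)+
    next
      case False
      show ?thesis unfolding append_Nil cartan_diff_Cons[OF False]
        by (rule GV.linear_compose_sub linear_lie_act_left[OF Nil]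
            linear_cartan_diff_family multilinear_hd[OF Nil])+
    qed
  next
    case (Cons a xs)
    have "Vector_Spaces.linear sG sV (\<lambda>z. L a f (xs @ z # ys))"
      using multilinear_lie_act[OF Cons.prems] unfolding multilinear_def by blast
    then have "Vector_Spaces.linear sG sV
        (\<lambda>z. L a f (xs @ z # ys) - D (\<lambda>zs. f (a # zs)) (xs @ z # ys))"
      by (rule GV.linear_compose_sub[OF _ Cons.IH[OF multilinear_Cons[OF Cons.prems]]])
    then show ?case by (simp add: cartan_diff_Cons)
  qed
  then show ?thesis unfolding multilinear_def by blast
qed

lemma lie_act_eq_0: "(\<And>zs. length zs = length ys \<Longrightarrow> f zs = 0) \<Longrightarrow> L x f ys = 0"
  by (induction ys arbitrary: f) (auto simp: additivity)

text \<open>Only values of \<open>f\<close> on lists one entry shorter than \<open>ys\<close> enter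
  \<open>D f ys\<close>, so \<open>D\<close> needs no degree index.\<close>

lemma cartan_diff_eq_0: "(\<And>zs. Suc (length zs) = length ys \<Longrightarrow> f zs = 0) \<Longrightarrow> D f ys = 0"
  by (induction ys arbitrary: f rule: induct_list012)
    (auto simp: additivity lie_act_eq_0 simp del: lie_act.simps)

text \<open>\<open>coboundary\<close> is cut off outside length \<open>n + 1\<close> and
  \<open>D\<close> is not; they still agree there because \<open>f\<close> vanishes outside length
  \<open>n\<close>.\<close>

lemma coboundary_eq:
  assumes "f \<in> cochains sG sV n"
  shows "coboundary sV br l r n f = D f"
proof
  fix xs
  show "coboundary sV br l r n f xs = D f xs"
  proof (cases "length xs = Suc n")
    case True
    then show ?thesis by (rule V.coboundary_eq_cartan_diff)
  next
    case False
    have "D f xs = 0"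
      by (rule cartan_diff_eq_0) (use assms False in \<open>auto simp: GV.cochains_iff\<close>)
    with False show ?thesis by (simp add: coboundary_def)
  qed
qed

lemma coboundary_cochains:
  assumes "f \<in> cochains sG sV n"
  shows "coboundary sV br l r n f \<in> cochains sG sV (Suc n)"
  using assms multilinear_cartan_diff coboundary_eq[OF assms]
  unfolding GV.cochains_iff by (auto intro!: cartan_diff_eq_0)

lemma lie_act_diff: "L x (\<lambda>zs. f zs - g zs) ys = L x f ys - L x g ys"
  by (induction ys arbitrary: f g) (auto simp: additivity)

lemma cartan_diff_diff: "D (\<lambda>zs. f zs - g zs) ys = D f ys - D g ys"
  by (induction ys arbitrary: f g rule: induct_list012)
    (auto simp: additivity lie_act_diff simp del: lie_act.simps)

lemma cartan_diff_uminus: "D (\<lambda>zs. - f zs) ys = - D f ys"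
  using cartan_diff_diff[of "\<lambda>_. 0" f ys] cartan_diff_eq_0[of ys "\<lambda>_. 0"] by simp

text \<open>Together with the version for \<open>D\<close>, this allows Cartan's formula, which
  needs a nonempty tail, to be applied under an outer operator.\<close>

lemma lie_act_cong:
  "(\<And>zs. length zs = length ys \<Longrightarrow> f zs = g zs) \<Longrightarrow> L x f ys = L x g ys"
  using lie_act_eq_0[of ys "\<lambda>zs. f zs - g zs"] by (simp add: lie_act_diff)

lemma cartan_diff_cong:
  "(\<And>zs. Suc (length zs) = length ys \<Longrightarrow> f zs = g zs) \<Longrightarrow> D f ys = D g ys"
  using cartan_diff_eq_0[of ys "\<lambda>zs. f zs - g zs"] by (simp add: cartan_diff_diff)

text \<open>On the empty list this is \<open>rep_ll\<close>. A further argument \<open>z\<close>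
  adds mixed terms that cancel and values of \<open>f\<close> that match by the Leibniz identity for
  \<open>x\<close>, \<open>y\<close>, \<open>z\<close>.\<close>

lemma lie_act_commutator:
  "multilinear sG sV f \<Longrightarrow> L x (L y f) zs - L y (L x f) zs = L (br x y) f zs"
proof (induction zs arbitrary: f)
  case Nil
  show ?case by (simp add: rep_ll[of x y])
next
  case (Cons z zs)
  have "f (br x (br y z) # zs) = f (br (br x y) z # zs) + f (br y (br x z) # zs)"
    using Cons.prems by (simp add: leibniz[of x y] multilinear_add)
  with Cons.IH[OF multilinear_Cons[OF Cons.prems, of z]] show ?case
    by (simp add: lie_act_diff algebra_simps)
qed

text \<open>On one argument this is \<open>rep_lr\<close>; on more, Cartan's formula reduces it to
  the commutators of \<open>L x\<close> with insertion of \<open>y\<close> and with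
  \<open>L y\<close>.\<close>

lemma lie_act_cartan_diff_commute:
  "multilinear sG sV f \<Longrightarrow> D (L x f) ys = L x (D f) ys"
proof (induction ys arbitrary: f)
  case Nil
  then show ?case by (simp add: additivity)
next
  case (Cons y ys)
  show ?case
  proof (cases "ys = []")
    case True
    then show ?thesis by (simp add: additivity rep_lr)
  next
    case False
    have "L x (\<lambda>zs. D f (y # zs)) ys = L x (\<lambda>zs. L y f zs - D (\<lambda>ws. f (y # ws)) zs) ys"
      by (rule lie_act_cong) (use False in \<open>auto intro!: cartan_diff_Cons\<close>)
    with False Cons.IH[OF multilinear_Cons[OF Cons.prems, of y]]
      lie_act_commutator[OF Cons.prems, of x y ys]
    show ?thesis
      by (simp add: cartan_diff_Cons cartan_diff_diff lie_act_diff algebra_simps)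
  qed
qed

text \<open>Two arguments are the case of \<open>rep_rr\<close>. Beyond that, Cartan's formula
  applied twice leaves \<open>L x (D f) - D (L x f)\<close>, which is zero, plus the square on a
  shorter list.\<close>

lemma cartan_diff_square: "multilinear sG sV f \<Longrightarrow> D (D f) ys = 0"
proof (induction ys arbitrary: f)
  case Nil
  then show ?case by simp
next
  case (Cons x ys)
  consider "ys = []" | y where "ys = [y]" | "length ys > 1"
    by (cases ys rule: remdups_adj.cases) auto
  then show ?case
  proof cases
    case 3
    then have "ys \<noteq> []" by auto
    \<comment> \<open>With \<open>length ys > 1\<close>, the lists on which the outer
      \<open>D\<close> evaluates its argument are nonempty, so Cartan's formula holds on
      them.\<close>
    have "D (\<lambda>zs. D f (x # zs)) ys = D (\<lambda>zs. L x f zs - D (\<lambda>ws. f (x # ws)) zs) ys"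
      by (rule cartan_diff_cong) (use 3 in \<open>auto intro!: cartan_diff_Cons\<close>)
    with Cons \<open>ys \<noteq> []\<close> show ?thesis
      by (simp add: cartan_diff_Cons cartan_diff_diff lie_act_cartan_diff_commute multilinear_Cons)
  qed (simp_all add: additivity rep_rr)
qed

end

section \<open>The representation twisted by the Rota-Baxter operators\<close>

context rota_baxter_representation
begin

lemma TV_additive: "TV (u + v) = TV u + TV v" "TV (u - v) = TV u - TV v" "TV (- u) = - TV u" "TV 0 = 0"
proof -
  interpret VV: vector_space_pair sV sV ..
  show "TV (u + v) = TV u + TV v" "TV (u - v) = TV u - TV v" "TV (- u) = - TV u" "TV 0 = 0"
    by (simp_all add: VV.linear_add[OF linear_TV] VV.linear_diff[OF linear_TV]
        VV.linear_neg[OF linear_TV] VV.linear_0[OF linear_TV])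
qed

text \<open>The Rota-Baxter identity makes \<open>T\<close> a homomorphism from the twisted bracket
  to the original one.\<close>

lemma T_bracket_star: "T (bracket_star br T x y) = br (T x) (T y)"
  by (simp add: bracket_star_def rota_baxter add.commute)

text \<open>The term subtracted in \<open>left_prime\<close> cancels one summand of
  \<open>rep_l_T\<close>. Thus \<open>TV\<close> intertwines the action through \<open>T\<close>
  with the twisted action.\<close>

lemma left_prime_TV: "left_prime T l TV x (TV u) = TV (l (T x) u)"
  by (simp add: left_prime_def rep_l_T TV_additive)

lemma right_prime_TV: "right_prime T r TV (TV u) x = TV (r u (T x))"
  by (simp add: right_prime_def rep_r_T TV_additive)

lemma leibniz_representation_star:
  "leibniz_representation sG (bracket_star br T) sV (left_prime T l TV) (right_prime T r TV)"
proof
  interpret GG: vector_space_pair sG sG ..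
  interpret VV: vector_space_pair sV sV ..
  show "bilinear_map sG sG sG (bracket_star br T)"
    unfolding bilinear_map_def bracket_star_def
    by (intro allI conjI GG.linear_compose_add linear_br linear_br_left
        linear_compose'[OF linear_T linear_br] linear_compose'[OF linear_T linear_br_left])
  show "bilinear_map sG sV sV (left_prime T l TV)"
    unfolding bilinear_map_def left_prime_def
    by (intro allI conjI GV.linear_compose_sub VV.linear_compose_sub linear_l
        linear_compose'[OF linear_T linear_l_left] linear_compose'[OF linear_l linear_TV]
        linear_compose'[OF linear_l_left linear_TV])
  show "bilinear_map sV sG sV (right_prime T r TV)"
    unfolding bilinear_map_def right_prime_def
    by (intro allI conjI GV.linear_compose_sub VV.linear_compose_sub linear_r_left
        linear_compose'[OF linear_T linear_r] linear_compose'[OF linear_r linear_TV]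
        linear_compose'[OF linear_r_left linear_TV])
  fix x y z :: 'g and u :: 'v
  show "bracket_star br T x (bracket_star br T y z) =
      bracket_star br T (bracket_star br T x y) z + bracket_star br T y (bracket_star br T x z)"
    \<comment> \<open>Only the outer brackets are expanded first, so that
      \<open>T_bracket_star\<close> can absorb \<open>T\<close> of an inner one.\<close>
    unfolding bracket_star_def[of br T x "bracket_star br T y z"]
      bracket_star_def[of br T "bracket_star br T x y"]
      bracket_star_def[of br T y "bracket_star br T x z"] T_bracket_star
    unfolding bracket_star_def
    by (simp add: additivity leibniz[of x "T y"] leibniz[of "T x" y] leibniz[of "T x" "T y"])
  show "left_prime T l TV x (left_prime T l TV y u) =
      left_prime T l TV (bracket_star br T x y) u + left_prime T l TV y (left_prime T l TV x u)"
    \<comment> \<open>Here and in the next two axioms, terms with nested \<open>TV\<close> cancel by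
      \<open>rep_l_T\<close> and \<open>rep_r_T\<close>. What remains is the original axiom with
      \<open>T\<close> on both algebra elements and, under \<open>TV\<close>, with \<open>T\<close>
      on just one.\<close>
    unfolding left_prime_def right_prime_def T_bracket_star unfolding bracket_star_def
    by (simp add: additivity TV_additive rep_l_T rep_r_T rep_ll[of "T x" "T y"] rep_ll[of "T x" y] rep_ll[of x "T y"])
  show "left_prime T l TV x (right_prime T r TV u y) =
      right_prime T r TV (left_prime T l TV x u) y + right_prime T r TV u (bracket_star br T x y)"
    unfolding left_prime_def right_prime_def T_bracket_star unfolding bracket_star_def
    by (simp add: additivity TV_additive rep_l_T rep_r_T rep_lr[of "T x" _ "T y"] rep_lr[of "T x" _ y] rep_lr[of x _ "T y"])
  show "right_prime T r TV u (bracket_star br T x y) =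
      right_prime T r TV (right_prime T r TV u x) y + left_prime T l TV x (right_prime T r TV u y)"
    unfolding left_prime_def right_prime_def T_bracket_star unfolding bracket_star_def
    by (simp add: additivity TV_additive rep_l_T rep_r_T rep_rr[of _ "T x" "T y"] rep_rr[of _ "T x" y] rep_rr[of _ x "T y"])
qed

text \<open>The Cartan calculus now also covers the Rota-Baxter coboundary, whose recursive form is
  \<open>star.D\<close>.\<close>

sublocale star: leibniz_representation sG "bracket_star br T" sV "left_prime T l TV" "right_prime T r TV"
  by (rule leibniz_representation_star)

section \<open>The map \<open>\<Phi>\<close> between the two complexes\<close>

abbreviation "\<Phi> \<equiv> rec_phi T TV"

lemma linear_rec_phi_family:
  assumes "\<And>zs. Vector_Spaces.linear sG sV (\<lambda>z. F z zs)"
  shows "Vector_Spaces.linear sG sV (\<lambda>z. \<Phi> (F z) ys)"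
  using assms
proof (induction ys arbitrary: F)
  case Nil
  then show ?case by simp
next
  case (Cons y ys)
  show ?case unfolding rec_phi.simps
    by (rule GV.linear_compose_sub Cons.IH linear_compose'[OF _ linear_TV] Cons.prems)+
qed

lemma multilinear_rec_phi:
  assumes "multilinear sG sV f"
  shows "multilinear sG sV (\<Phi> f)"
proof -
  have "Vector_Spaces.linear sG sV (\<lambda>z. \<Phi> f (xs @ z # ys))" for xs ys
    using assms
  proof (induction xs arbitrary: f)
    case Nil
    have "Vector_Spaces.linear sG sV (\<lambda>z. f (T z # zs))" for zs
      using linear_compose'[OF linear_T multilinear_hd[OF Nil]] .
    moreover have "Vector_Spaces.linear sG sV (\<lambda>z. TV (f (z # map T ys)))"
      using linear_compose'[OF multilinear_hd[OF Nil] linear_TV] .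
    ultimately show ?case unfolding append_Nil rec_phi.simps
      by (intro GV.linear_compose_sub linear_rec_phi_family)
  next
    case (Cons a xs)
    have "Vector_Spaces.linear sG sV (\<lambda>z. f ((a # map T xs) @ z # map T ys))"
      using Cons.prems unfolding multilinear_def by blast
    from linear_compose'[OF linear_compose'[OF linear_T this] linear_TV]
    have "Vector_Spaces.linear sG sV (\<lambda>z. TV (f (a # map T (xs @ z # ys))))" by simp
    then show ?case unfolding append_Cons rec_phi.simps
      by (rule GV.linear_compose_sub[OF Cons.IH[OF multilinear_Cons[OF Cons.prems]]])
  qed
  then show ?thesis unfolding multilinear_def by blast
qed

lemma rec_phi_eq_0: "(\<And>zs. length zs = length ys \<Longrightarrow> f zs = 0) \<Longrightarrow> \<Phi> f ys = 0"
  by (induction ys arbitrary: f) (auto simp: TV_additive)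

lemma rec_phi_diff: "\<Phi> (\<lambda>zs. f zs - g zs) ys = \<Phi> f ys - \<Phi> g ys"
  by (induction ys arbitrary: f g) (auto simp: TV_additive)

lemma rec_phi_cong:
  "(\<And>zs. length zs = length ys \<Longrightarrow> f zs = g zs) \<Longrightarrow> \<Phi> f ys = \<Phi> g ys"
  using rec_phi_eq_0[of ys "\<lambda>zs. f zs - g zs"] by (simp add: rec_phi_diff)

lemma rb_phi_eq:
  assumes "f \<in> cochains sG sV n"
  shows "rb_phi T TV n f = \<Phi> f"
proof
  fix xs
  show "rb_phi T TV n f xs = \<Phi> f xs"
  proof (cases "length xs = n")
    case True
    then show ?thesis by (rule rb_phi_eq_rec_phi)
  next
    case False
    have "\<Phi> f xs = 0"
      by (rule rec_phi_eq_0) (use assms False in \<open>auto simp: GV.cochains_iff\<close>)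
    with False show ?thesis by (simp add: rb_phi_def)
  qed
qed

lemma rb_phi_cochains:
  assumes "f \<in> cochains sG sV n"
  shows "rb_phi T TV n f \<in> cochains sG sV n"
  using assms multilinear_rec_phi rb_phi_eq[OF assms]
  unfolding GV.cochains_iff by (auto intro!: rec_phi_eq_0)

lemma star_lie_act_TV:
  "star.L x (\<lambda>zs. TV (f (map T zs))) ys = TV (L (T x) f (map T ys))"
proof (induction ys arbitrary: f)
  case Nil
  show ?case by (simp add: left_prime_TV)
next
  case (Cons y ys)
  then show ?case
    using Cons.IH[of "\<lambda>zs. f (T y # zs)"] by (simp add: TV_additive T_bracket_star)
qed

text \<open>Precomposing with \<open>T\<close> and postcomposing with \<open>TV\<close> respects
  both actions, hence commutes with the differentials by Cartan's formula. These are the correction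
  terms in \<open>\<Phi>\<close>.\<close>

lemma star_cartan_diff_TV:
  "star.D (\<lambda>zs. TV (f (map T zs))) ys = TV (D f (map T ys))"
proof (induction ys arbitrary: f)
  case Nil
  show ?case by (simp add: TV_additive)
next
  case (Cons y ys)
  show ?case
  proof (cases "ys = []")
    case True
    then show ?thesis by (simp add: right_prime_TV TV_additive)
  next
    case False
    then show ?thesis using Cons.IH[of "\<lambda>zs. f (T y # zs)"]
      by (simp add: cartan_diff_Cons star.cartan_diff_Cons star_lie_act_TV TV_additive)
  qed
qed

text \<open>The empty list is the definition of \<open>left_prime\<close>. In later slots the
  summand \<open>br (T x) y\<close> of the twisted bracket belongs to
  \<open>\<Phi> (L (T x) f)\<close> and \<open>br x (T y)\<close> to the correction with
  \<open>L x f\<close>.\<close>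

lemma star_lie_act_rec_phi:
  "multilinear sG sV f \<Longrightarrow> star.L x (\<Phi> f) ys = \<Phi> (L (T x) f) ys - TV (L x f (map T ys))"
proof (induction ys arbitrary: f)
  case Nil
  show ?case by (simp add: left_prime_def)
next
  case (Cons y ys)
  have "f (bracket_star br T x y # map T ys) =
      f (br x (T y) # map T ys) + f (br (T x) y # map T ys)"
    using Cons.prems by (simp add: bracket_star_def multilinear_add)
  with Cons.IH[OF multilinear_Cons[OF Cons.prems, of "T y"]]
    star_lie_act_TV[of x "\<lambda>zs. f (y # zs)" ys]
  show ?case
    by (simp add: star.lie_act_diff rec_phi_diff TV_additive T_bracket_star algebra_simps)
qed

text \<open>After Cartan's formula for \<open>star.D\<close>, the terms with \<open>T x\<close>
  inserted combine to \<open>\<Phi>\<close> of \<open>D f\<close> at \<open>T x\<close>, and those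
  under \<open>TV\<close> combine to \<open>D f\<close> at \<open>x\<close>.\<close>

lemma star_cartan_diff_rec_phi: "multilinear sG sV f \<Longrightarrow> star.D (\<Phi> f) ys = \<Phi> (D f) ys"
proof (induction ys arbitrary: f)
  case Nil
  then show ?case by simp
next
  case (Cons x ys)
  show ?case
  proof (cases "ys = []")
    case True
    then show ?thesis by (simp add: right_prime_def TV_additive)
  next
    case False
    have "\<Phi> (\<lambda>zs. D f (T x # zs)) ys = \<Phi> (\<lambda>zs. L (T x) f zs - D (\<lambda>ws. f (T x # ws)) zs) ys"
      by (rule rec_phi_cong) (use False in \<open>auto intro!: cartan_diff_Cons\<close>)
    with False Cons.IH[OF multilinear_Cons[OF Cons.prems, of "T x"]]
      star_lie_act_rec_phi[OF Cons.prems, of x ys] star_cartan_diff_TV[of "\<lambda>zs. f (x # zs)" ys]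
    show ?thesis
      by (simp add: cartan_diff_Cons star.cartan_diff_Cons star.cartan_diff_diff rec_phi_diff
          TV_additive algebra_simps)
  qed
qed

end

section \<open>The square of the total differential\<close>

theorem theorem4p3:
  fixes sG :: "'k::field \<Rightarrow> 'g::ab_group_add \<Rightarrow> 'g"
    and br :: "'g \<Rightarrow> 'g \<Rightarrow> 'g"
    and T :: "'g \<Rightarrow> 'g"
    and sV :: "'k \<Rightarrow> 'v::ab_group_add \<Rightarrow> 'v"
    and l :: "'g \<Rightarrow> 'v \<Rightarrow> 'v"
    and r :: "'v \<Rightarrow> 'g \<Rightarrow> 'v"
    and TV :: "'v \<Rightarrow> 'v"
  assumes "rota_baxter_leibniz_algebra sG br T"
    and "rota_baxter_representation sG br T sV l r TV"
  shows "\<forall>n. \<forall>c \<in> rbla_cochains sG sV n.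
           rbla_diff sV br T l r TV n c \<in> rbla_cochains sG sV (n + 1) \<and>
           (rbla_diff sV br T l r TV (n + 1) \<circ> rbla_diff sV br T l r TV n) c = 0"
proof (intro allI ballI)
  interpret rota_baxter_representation sG br T sV l r TV by (rule assms(2))
  fix n c
  assume c: "c \<in> rbla_cochains sG sV n"
  obtain \<alpha> \<beta> where ab: "c = (\<alpha>, \<beta>)" by (cases c)
  let ?d = "coboundary sV br l r" and ?p = "rb_phi T TV" and ?e = "rbo_coboundary sV br T l r TV"
  have a: "\<alpha> \<in> cochains sG sV n" using c by (auto simp: ab rbla_cochains_def split: if_splits)
  have ml_a: "multilinear sG sV \<alpha>" using a by (simp add: GV.cochains_iff)
  define \<gamma> where "\<gamma> = (if n = 0 then - ?p 0 \<alpha> else - ?e (n - 1) \<beta> - ?p n \<alpha>)"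
  have d: "rbla_diff sV br T l r TV n c = (?d n \<alpha>, \<gamma>)"
    by (simp add: rbla_diff_def ab \<gamma>_def)
  have da: "?d n \<alpha> \<in> cochains sG sV (Suc n)" by (rule coboundary_cochains[OF a])
  \<comment> \<open>With \<gamma> the second component of \<open>d c\<close>, this says that the
    second component of \<open>d (d c)\<close> vanishes. In positive degree, the \<beta> part dies
    because \<open>star.D\<close> squares to zero, and the \<alpha> part is moved through
    \<open>\<Phi>\<close>.\<close>
  have g: "\<gamma> \<in> cochains sG sV n \<and> (\<forall>ys. star.D \<gamma> ys = - \<Phi> (D \<alpha>) ys)"
  proof (cases n)
    case 0
    then have "\<gamma> = (\<lambda>zs. - \<Phi> \<alpha> zs)" using rb_phi_eq[OF a] by (auto simp: \<gamma>_def)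
    moreover have "\<gamma> \<in> cochains sG sV n"
      using 0 rb_phi_cochains[OF a] by (simp add: \<gamma>_def GV.cochains_uminus)
    ultimately show ?thesis by (simp add: star.cartan_diff_uminus star_cartan_diff_rec_phi ml_a)
  next
    case (Suc m)
    then have b: "\<beta> \<in> cochains sG sV m" using c by (auto simp: ab rbla_cochains_def)
    have e: "?e m \<beta> = star.D \<beta>"
      unfolding rbo_coboundary_def by (rule star.coboundary_eq[OF b])
    have "?e m \<beta> \<in> cochains sG sV n"
      unfolding rbo_coboundary_def Suc by (rule star.coboundary_cochains[OF b])
    then have "\<gamma> \<in> cochains sG sV n"
      using Suc rb_phi_cochains[OF a] by (simp add: \<gamma>_def GV.cochains_diff GV.cochains_uminus)
    moreover have "\<gamma> = (\<lambda>zs. - star.D \<beta> zs - \<Phi> \<alpha> zs)"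
      using Suc rb_phi_eq[OF a] e by (auto simp: \<gamma>_def)
    ultimately show ?thesis
      using star.cartan_diff_square[of \<beta>] b
      by (simp add: star.cartan_diff_diff star.cartan_diff_uminus star_cartan_diff_rec_phi ml_a
          GV.cochains_iff)
  qed
  have "?d (Suc n) (?d n \<alpha>) = 0"
    unfolding coboundary_eq[OF da] unfolding coboundary_eq[OF a] using cartan_diff_square[OF ml_a] by auto
  \<comment> \<open>The index of \<open>?e\<close> is \<open>n\<close>: total degree
    \<open>n + 1\<close> carries degree \<open>n\<close> in its second component.\<close>
  moreover have "- ?e n \<gamma> - ?p (Suc n) (?d n \<alpha>) = 0"
    unfolding rb_phi_eq[OF da] unfolding coboundary_eq[OF a] rbo_coboundary_def
      star.coboundary_eq[OF conjunct1[OF g]]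
    using g by auto
  ultimately show "rbla_diff sV br T l r TV n c \<in> rbla_cochains sG sV (n + 1) \<and>
      (rbla_diff sV br T l r TV (n + 1) \<circ> rbla_diff sV br T l r TV n) c = 0"
    using da g by (simp add: d rbla_cochains_def) (simp add: rbla_diff_def zero_prod_def)
qed

end
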